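(* Let $\mathbb{A}=(A_1,\dots,A_m)$, where $A_i\in M_n(\mathbb{R}_+)$ for all $i=1,\dots,m$, and let $1\le k\le n$ be a positive integer. Then the following assertions are true. (i) Suppose $A_1=\dots=A_m=A=(a_{ij})$. If $1\le k<n$, then $W_{\max}^k(\mathbb{A})=\{(a,\dots,a): s\le a\le t\}$, where $s=\min\{\bigoplus_{j=1}^k a_{i_ji_j}: 1\le i_1<i_2<\dots<i_k\le n\}$ and $t=\max_{1\le i,j\le n}a_{ij}$. If $k=n$, then $W_{\max}^n(\mathbb{A})=\{(tr_{\otimes}(A),\dots,tr_{\otimes}(A))\}$. (ii) $W_{\max}^k(A_1\oplus\alpha_1I,\dots,A_m\oplus\alpha_mI)=W_{\max}^k(A_1,\dots,A_m)\oplus\{(\alpha_1,\dots,\alpha_m)\}$ and $W_{\max}^k(\mathbb{A}\oplus\mathbb{B})\subseteq W_{\max}^k(\mathbb{A})\oplus W_{\max}^k(\mathbb{B})$, where $\alpha_1,\dots,\alpha_m\in\mathbb{R}_+$ and $\mathbb{B}=(B_1,\dots,B_m)$ with $B_i\in M_n(\mathbb{R}_+)$ for all $i=1,\dots,m$. (iii) $W_{\max}^k(U^t\otimes A_1\otimes U,\dots,U^t\otimes A_m\otimes U)=W_{\max}^k(A_1,\dots,A_m)$, where $U\in\mathcal{U}_n$. (iv) $W_{\max}^n(\alpha_1A_1,\dots,\alpha_mA_m)=\{(\alpha_1tr_{\otimes}(A_1),\dots,\alpha_mtr_{\otimes}(A_m))\}$, where $\alpha_1,\dots,\alpha_m\in\mathbb{R}_+$.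 (v) If $B_1,\dots,B_m\in M_l(\mathbb{R}_+)$ are formed by taking rows and columns $i_1,\dots,i_l$ (distinct indices) from $A_1,\dots,A_m$, respectively, and $k\le l$, then $W_{\max}^k(\mathbb{B})\subseteq W_{\max}^k(\mathbb{A})$, where $\mathbb{B}=(B_1,\dots,B_m)$. Consequently, if $V=[e_{i_1},\dots,e_{i_s}]\in M_{n\times s}(\mathbb{R}_+)$ with distinct indices $i_1,\dots,i_s$ and $1\le k\le s\le n$, then $W_{\max}^k(V^t\otimes A_1\otimes V,\dots,V^t\otimes A_m\otimes V)\subseteq W_{\max}^k(A_1,\dots,A_m)$, and equality holds if $s=n$. (vi) Let $B_1,\dots,B_m\in M_p(\mathbb{R}_+)$ and let $D_i=\begin{bmatrix}A_i&0\\0&B_i\end{bmatrix}$ for $i=1,\dots,m$. Moreover, let $1\le k\le\min\{n,p\}$ be a positive integer. Then $W_{\max}^k(\mathbb{A})\cup W_{\max}^k(\mathbb{B})\subseteq W_{\max}^k(\mathbb{D})$, where $\mathbb{B}=(B_1,\dots,B_m)$ and $\mathbb{D}=(D_1,\dots,D_m)$. (vii) If $m-1<k<n$, then $W_{\max}^{k+1}(\mathbb{A})\subseteq W_{\max}^k(\mathbb{A})$.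
   Context: $\mathbb{R}_+=[0,\infty)$; $M_{m\times n}(\mathbb{R}_+)$ is the set of $m\times n$ matrices with entries in $\mathbb{R}_+$, and $M_n(\mathbb{R}_+)=M_{n\times n}(\mathbb{R}_+)$. For scalars $a\oplus b=\max\{a,b\}$; for matrices or vectors $\oplus$ is the entrywise maximum, and $(A\otimes B)_{ij}=\max_k a_{ik}b_{kj}$. $X^t$ is the transpose, $I$ and $I_k$ are identity matrices, $e_i$ is the $i$-th standard basis vector, and $tr_{\otimes}(A)=\max_i a_{ii}$. For tuples of matrices, $\mathbb{A}\oplus\mathbb{B}=(A_1\oplus B_1,\dots,A_m\oplus B_m)$; for sets $S,T\subseteq\mathbb{R}_+^m$, $S\oplus T=\{s\oplus t:s\in S,t\in T\}$. For $1\le k\le n$, $\mathcal{X}_{n\times k}=\{X\in M_{n\times k}(\mathbb{R}_+):X^t\otimes X=I_k\}$ and $\mathcal{U}_n=\mathcal{X}_{n\times n}$ (which is the set of $n\times n$ permutation matrices). For $\mathbb{A}=(A_1,\dots,A_m)$ with $A_i\in M_n(\mathbb{R}_+)$ and $1\le k\le n$, the max joint $k$-numerical range is \[ W_{\max}^k(\mathbb{A})=\{(tr_{\otimes}(X^t\otimes A_1\otimes X),\dots,tr_{\otimes}(X^t\otimes A_m\otimes X)): X\in\mathcal{X}_{n\times k}\}\subseteq\mathbb{R}_+^m . \] *)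

theory Defs
  imports "Jordan_Normal_Form.Matrix"
begin

text \<open>
  Matrices are those of \<^theory>\<open>Jordan_Normal_Form.Matrix\<close>, so indices start at 0.
  An \<open>m\<close>-tuple of matrices or of reals is a list of length \<open>m\<close>.
\<close>

definition nonneg_mat :: "nat \<Rightarrow> nat \<Rightarrow> real mat set" where
  "nonneg_mat m n = {A \<in> carrier_mat m n. \<forall>i<m. \<forall>j<n. 0 \<le> A $$ (i, j)}"

definition mat_oplus :: "real mat \<Rightarrow> real mat \<Rightarrow> real mat" (infixl \<open>\<oplus>\<^sub>m\<close> 65) where
  "A \<oplus>\<^sub>m B = mat (dim_row A) (dim_col A) (\<lambda>ij. max (A $$ ij) (B $$ ij))"

text \<open>
  The value of \<open>Max {}\<close> is unspecified, so the product is meaningful only when the inner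
  dimension is positive, and the trace only when the matrix is nonempty.
\<close>

definition mat_otimes :: "real mat \<Rightarrow> real mat \<Rightarrow> real mat" (infixl \<open>\<otimes>\<^sub>m\<close> 70) where
  "A \<otimes>\<^sub>m B = mat (dim_row A) (dim_col B)
     (\<lambda>(i, j). MAX k\<in>{..<dim_col A}. A $$ (i, k) * B $$ (k, j))"

definition tr_otimes :: "real mat \<Rightarrow> real" where
  "tr_otimes A = (MAX i\<in>{..<dim_row A}. A $$ (i, i))"

definition mats_oplus :: "real mat list \<Rightarrow> real mat list \<Rightarrow> real mat list"
    (infixl \<open>\<oplus>\<^sub>t\<close> 65) where
  "As \<oplus>\<^sub>t Bs = map2 (\<oplus>\<^sub>m) As Bs"

definition set_oplus :: "real list set \<Rightarrow> real list set \<Rightarrow> real list set"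
    (infixl \<open>\<oplus>\<^sub>s\<close> 65) where
  "S \<oplus>\<^sub>s T = {map2 max s t | s t. s \<in> S \<and> t \<in> T}"

definition max_isometries :: "nat \<Rightarrow> nat \<Rightarrow> real mat set" where
  "max_isometries n k = {X \<in> nonneg_mat n k. transpose_mat X \<otimes>\<^sub>m X = 1\<^sub>m k}"

definition max_unitaries :: "nat \<Rightarrow> real mat set" where
  "max_unitaries n = max_isometries n n"

text \<open>The size \<open>n\<close> of the matrices is an explicit argument, followed by \<open>k\<close>.\<close>

definition W_max :: "nat \<Rightarrow> nat \<Rightarrow> real mat list \<Rightarrow> real list set" where
  "W_max n k As =
     {map (\<lambda>A. tr_otimes (transpose_mat X \<otimes>\<^sub>m A \<otimes>\<^sub>m X)) As | X. X \<in> max_isometries n k}"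

text \<open>Rows and columns appear in the order in which \<open>idx\<close> lists them.\<close>

definition principal_submat :: "nat list \<Rightarrow> real mat \<Rightarrow> real mat" where
  "principal_submat idx A =
     mat (length idx) (length idx) (\<lambda>(p, q). A $$ (idx ! p, idx ! q))"

end

theory Submission
  imports Defs
begin

text \<open>
  A matrix \<open>X\<close> satisfies \<open>X\<^sup>t \<otimes> X = I\<close> exactly when its entries are at most 1, every column
  contains a 1, and distinct columns have disjoint supports. Unit columns at distinct indices
  therefore turn \<open>X\<^sup>t \<otimes> A \<otimes> X\<close> into a principal submatrix, and square isometries are permutation
  matrices; as isometries compose, this gives (iii)--(vi). For (vii), each of the \<open>m \<le> k\<close> traces is
  attained at a single column of an \<open>n \<times> (k + 1)\<close> isometry, so some column can be dropped
  without changing any trace. For the interval in (i), the trace is a continuous function of the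
  entries of \<open>X\<close>, and a path of isometries leads from the columns \<open>e\<^sub>i\<close> of a minimizing index set to
  an isometry having both \<open>p\<close> and \<open>q\<close> in the support of one column, where \<open>a\<^sub>p\<^sub>q\<close> is the largest entry.
\<close>

section \<open>Finite maxima of real numbers\<close>

text \<open>A real number is determined by its upper bounds. Equalities between expressions built
  from maxima are therefore proved by rewriting each side into the statement that all its terms are
  at most \<open>c\<close>.\<close>

lemma real_eqI_le_iff:
  fixes x y :: real
  assumes "\<And>c. x \<le> c \<longleftrightarrow> y \<le> c"
  shows "x = y"
  using assms by (simp add: order.eq_iff)

text \<open>Multiplication by a nonnegative constant is monotone and so commutes with
  \<open>Max\<close>; the scaled maximum can then be bounded term by term.\<close>

lemma Max_image_mult_le_iff:
  fixes f :: "'a \<Rightarrow> real"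
  assumes "finite S" "S \<noteq> {}" "0 \<le> c"
  shows "Max (f ` S) * c \<le> d \<longleftrightarrow> (\<forall>x\<in>S. f x * c \<le> d)"
proof -
  have "Max (f ` S) * c = Max ((\<lambda>y. y * c) ` f ` S)"
    by (rule mono_Max_commute) (use assms in \<open>auto intro!: monoI mult_right_mono\<close>)
  then show ?thesis using assms by (simp add: image_image)
qed

lemma continuous_on_Max_image:
  fixes f :: "'a \<Rightarrow> 'b::topological_space \<Rightarrow> real"
  assumes "finite I" "I \<noteq> {}" "\<And>i. i \<in> I \<Longrightarrow> continuous_on S (f i)"
  shows "continuous_on S (\<lambda>x. MAX i\<in>I. f i x)"
  using assms
proof (induction I rule: finite_ne_induct)
  case (insert i I)
  then have "(\<lambda>x. MAX j\<in>insert i I. f j x) = (\<lambda>x. max (f i x) (MAX j\<in>I. f j x))"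
    by simp
  then show ?case using insert by (simp add: continuous_on_max)
qed simp

section \<open>Nonnegative matrices and the max-times product\<close>

lemma nonneg_matD:
  assumes "A \<in> nonneg_mat a b"
  shows "A \<in> carrier_mat a b" "dim_row A = a" "dim_col A = b"
    "i < a \<Longrightarrow> j < b \<Longrightarrow> 0 \<le> A $$ (i, j)"
  using assms by (auto simp: nonneg_mat_def)

lemma transpose_nonneg_mat: "A \<in> nonneg_mat a b \<Longrightarrow> transpose_mat A \<in> nonneg_mat b a"
  by (auto simp: nonneg_mat_def)

lemma one_nonneg_mat: "1\<^sub>m n \<in> nonneg_mat n n"
  by (auto simp: nonneg_mat_def)

text \<open>Together with the next lemma this turns entries of products into bounded quantifiers.
  The hypothesis \<open>0 < b\<close> keeps the index set nonempty, since \<open>Max {}\<close> is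
  unspecified.\<close>

lemma otimes_le_iff:
  assumes "dim_row A = a" "dim_col A = b" "dim_col B = c" "0 < b" "i < a" "j < c"
  shows "(A \<otimes>\<^sub>m B) $$ (i, j) \<le> d \<longleftrightarrow> (\<forall>k<b. A $$ (i, k) * B $$ (k, j) \<le> d)"
proof -
  have "{..<b} \<noteq> {}" using \<open>0 < b\<close> by auto
  then show ?thesis using assms by (auto simp: mat_otimes_def)
qed

lemma otimes_mult_le_iff:
  assumes "dim_row A = a" "dim_col A = b" "dim_col B = c" "0 < b" "i < a" "j < c" "0 \<le> x"
  shows "(A \<otimes>\<^sub>m B) $$ (i, j) * x \<le> d \<longleftrightarrow> (\<forall>k<b. A $$ (i, k) * B $$ (k, j) * x \<le> d)"
proof -
  have "{..<b} \<noteq> {}" using \<open>0 < b\<close> by auto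
  then show ?thesis
    using assms Max_image_mult_le_iff[of "{..<b}" x "\<lambda>k. A $$ (i, k) * B $$ (k, j)" d]
    by (simp add: mat_otimes_def Ball_def)
qed

lemma otimes_nonneg_mat:
  assumes "A \<in> nonneg_mat a b" "B \<in> nonneg_mat b c" "0 < b"
  shows "A \<otimes>\<^sub>m B \<in> nonneg_mat a c"
proof -
  have "0 \<le> (A \<otimes>\<^sub>m B) $$ (i, j)" if "i < a" "j < c" for i j
  proof -
    \<comment> \<open>One nonnegative term bounds the maximum from below; index 0 is available
      because \<open>0 < b\<close>.\<close>
    have "0 \<le> A $$ (i, 0) * B $$ (0, j)"
      using assms that by (simp add: nonneg_matD(4))
    also have "\<dots> \<le> (A \<otimes>\<^sub>m B) $$ (i, j)"
      using otimes_le_iff[of A a b B c i j "(A \<otimes>\<^sub>m B) $$ (i, j)"] assms that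
      by (simp add: nonneg_matD(2,3))
    finally show ?thesis .
  qed
  moreover have "A \<otimes>\<^sub>m B \<in> carrier_mat a c"
    using assms by (auto simp: mat_otimes_def nonneg_matD(2,3))
  ultimately show ?thesis by (simp add: nonneg_mat_def)
qed

lemma transpose_otimes:
  assumes "dim_col A = dim_row B"
  shows "transpose_mat (A \<otimes>\<^sub>m B) = transpose_mat B \<otimes>\<^sub>m transpose_mat A"
proof (rule eq_matI)
  fix i j
  assume "i < dim_row (transpose_mat B \<otimes>\<^sub>m transpose_mat A)"
    and "j < dim_col (transpose_mat B \<otimes>\<^sub>m transpose_mat A)"
  then have ij: "i < dim_col B" "j < dim_row A" by (auto simp: mat_otimes_def)
  have "(\<lambda>k. A $$ (j, k) * B $$ (k, i)) ` {..<dim_row B}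
      = (\<lambda>k. transpose_mat B $$ (i, k) * transpose_mat A $$ (k, j)) ` {..<dim_row B}"
    using ij assms by (intro image_cong) auto
  then show "transpose_mat (A \<otimes>\<^sub>m B) $$ (i, j) = (transpose_mat B \<otimes>\<^sub>m transpose_mat A) $$ (i, j)"
    using ij assms by (simp add: mat_otimes_def)
qed (auto simp: mat_otimes_def)

text \<open>Each side is at most \<open>e\<close> exactly when all triple products of entries are,
  and the two quantifiers over inner indices commute. Nonnegativity of the outer factor lets it move
  inside the inner maximum.\<close>

lemma otimes_assoc:
  assumes A: "A \<in> nonneg_mat a b" and B: "B \<in> nonneg_mat b c" and C: "C \<in> nonneg_mat c d"
    and pos: "0 < b" "0 < c"
  shows "A \<otimes>\<^sub>m B \<otimes>\<^sub>m C = A \<otimes>\<^sub>m (B \<otimes>\<^sub>m C)"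
proof (rule eq_matI)
  have AB: "A \<otimes>\<^sub>m B \<in> nonneg_mat a c" and BC: "B \<otimes>\<^sub>m C \<in> nonneg_mat b d"
    using assms otimes_nonneg_mat by blast+
  note dims = nonneg_matD(2,3)[OF A] nonneg_matD(2,3)[OF B] nonneg_matD(2,3)[OF C]
    nonneg_matD(2,3)[OF AB] nonneg_matD(2,3)[OF BC]
  fix i j
  assume "i < dim_row (A \<otimes>\<^sub>m (B \<otimes>\<^sub>m C))" and "j < dim_col (A \<otimes>\<^sub>m (B \<otimes>\<^sub>m C))"
  then have ij: "i < a" "j < d" using dims by (auto simp: mat_otimes_def)
  show "(A \<otimes>\<^sub>m B \<otimes>\<^sub>m C) $$ (i, j) = (A \<otimes>\<^sub>m (B \<otimes>\<^sub>m C)) $$ (i, j)"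
  proof (rule real_eqI_le_iff)
    fix e
    have "(A \<otimes>\<^sub>m B \<otimes>\<^sub>m C) $$ (i, j) \<le> e \<longleftrightarrow> (\<forall>l<c. (A \<otimes>\<^sub>m B) $$ (i, l) * C $$ (l, j) \<le> e)"
      using ij pos dims otimes_le_iff[of "A \<otimes>\<^sub>m B" a c C d i j e] by simp
    also have "\<dots> \<longleftrightarrow> (\<forall>l<c. \<forall>k<b. A $$ (i, k) * B $$ (k, l) * C $$ (l, j) \<le> e)"
      using ij pos dims nonneg_matD(4)[OF C] otimes_mult_le_iff[of A a b B c i] by simp
    also have "\<dots> \<longleftrightarrow> (\<forall>k<b. \<forall>l<c. B $$ (k, l) * C $$ (l, j) * A $$ (i, k) \<le> e)"
      by (auto simp: mult_ac)
    also have "\<dots> \<longleftrightarrow> (\<forall>k<b. A $$ (i, k) * (B \<otimes>\<^sub>m C) $$ (k, j) \<le> e)"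
      using ij pos dims nonneg_matD(4)[OF A] otimes_mult_le_iff[of B b c C d _ j]
      by (simp add: mult.commute)
    also have "\<dots> \<longleftrightarrow> (A \<otimes>\<^sub>m (B \<otimes>\<^sub>m C)) $$ (i, j) \<le> e"
      using ij pos dims otimes_le_iff[of A a b "B \<otimes>\<^sub>m C" d i j e] by simp
    finally show "(A \<otimes>\<^sub>m B \<otimes>\<^sub>m C) $$ (i, j) \<le> e \<longleftrightarrow> (A \<otimes>\<^sub>m (B \<otimes>\<^sub>m C)) $$ (i, j) \<le> e" .
  qed
qed (auto simp: mat_otimes_def)

lemma one_otimes:
  assumes "A \<in> nonneg_mat n k"
  shows "1\<^sub>m n \<otimes>\<^sub>m A = A"
proof (rule eq_matI)
  fix i j assume "i < dim_row A" "j < dim_col A"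
  then have ij: "i < n" "j < k" using assms by (auto simp: nonneg_matD)
  show "(1\<^sub>m n \<otimes>\<^sub>m A) $$ (i, j) = A $$ (i, j)"
  proof (rule real_eqI_le_iff)
    fix c
    have "(1\<^sub>m n \<otimes>\<^sub>m A) $$ (i, j) \<le> c \<longleftrightarrow> (\<forall>l<n. 1\<^sub>m n $$ (i, l) * A $$ (l, j) \<le> c)"
      using ij assms by (intro otimes_le_iff) (auto simp: nonneg_matD)
    \<comment> \<open>The terms with \<open>l \<noteq> i\<close> are 0; they impose no further bound
      on \<open>c\<close> because the entry of \<open>A\<close> is nonnegative.\<close>
    also have "\<dots> \<longleftrightarrow> A $$ (i, j) \<le> c"
      using ij nonneg_matD(4)[OF assms, of i j] by auto
    finally show "(1\<^sub>m n \<otimes>\<^sub>m A) $$ (i, j) \<le> c \<longleftrightarrow> A $$ (i, j) \<le> c" .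
  qed
qed (use assms in \<open>auto simp: mat_otimes_def nonneg_matD\<close>)

section \<open>Compressions of a square matrix\<close>

text \<open>Input-only, so that facts about it are literally about the terms in \<open>W_max\<close>
  and nothing has to be unfolded.\<close>

abbreviation (input) sandwich :: "real mat \<Rightarrow> real mat \<Rightarrow> real mat" where
  "sandwich X A \<equiv> transpose_mat X \<otimes>\<^sub>m A \<otimes>\<^sub>m X"

lemma sandwich_nonneg_mat:
  assumes "X \<in> nonneg_mat n k" "A \<in> nonneg_mat n n" "0 < n"
  shows "sandwich X A \<in> nonneg_mat k k"
  using assms by (blast intro: otimes_nonneg_mat transpose_nonneg_mat)

text \<open>Transposition reverses products, and associativity regroups the five factors. This is
  what allows one compression to be absorbed into another.\<close>

lemma sandwich_sandwich:
  assumes V: "V \<in> nonneg_mat n l" and X: "X \<in> nonneg_mat l k" and A: "A \<in> nonneg_mat n n"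
    and pos: "0 < n" "0 < l"
  shows "sandwich X (sandwich V A) = sandwich (V \<otimes>\<^sub>m X) A"
proof -
  note V' = transpose_nonneg_mat[OF V] and X' = transpose_nonneg_mat[OF X]
  note V'A = otimes_nonneg_mat[OF V' A \<open>0 < n\<close>]
  note V'AV = otimes_nonneg_mat[OF V'A V \<open>0 < n\<close>]
  note X'V' = otimes_nonneg_mat[OF X' V' \<open>0 < l\<close>]
  have "sandwich (V \<otimes>\<^sub>m X) A = transpose_mat X \<otimes>\<^sub>m transpose_mat V \<otimes>\<^sub>m A \<otimes>\<^sub>m (V \<otimes>\<^sub>m X)"
    using V X by (simp add: transpose_otimes nonneg_matD)
  also have "\<dots> = transpose_mat X \<otimes>\<^sub>m transpose_mat V \<otimes>\<^sub>m A \<otimes>\<^sub>m V \<otimes>\<^sub>m X"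
    using otimes_assoc[OF otimes_nonneg_mat[OF X'V' A \<open>0 < n\<close>] V X pos] ..
  also have "transpose_mat X \<otimes>\<^sub>m transpose_mat V \<otimes>\<^sub>m A = transpose_mat X \<otimes>\<^sub>m (transpose_mat V \<otimes>\<^sub>m A)"
    by (rule otimes_assoc[OF X' V' A \<open>0 < l\<close> \<open>0 < n\<close>])
  also have "\<dots> \<otimes>\<^sub>m V = transpose_mat X \<otimes>\<^sub>m sandwich V A"
    by (rule otimes_assoc[OF X' V'A V \<open>0 < l\<close> \<open>0 < n\<close>])
  finally show ?thesis ..
qed

text \<open>Presents the isometry condition as a compression of the identity, so that the
  composition law for compressions applies to it.\<close>

lemma sandwich_one:
  assumes "X \<in> nonneg_mat n k"
  shows "sandwich X (1\<^sub>m n) = transpose_mat X \<otimes>\<^sub>m X"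
proof -
  have "transpose_mat X \<otimes>\<^sub>m 1\<^sub>m n = transpose_mat (1\<^sub>m n \<otimes>\<^sub>m X)"
    using assms by (simp add: transpose_otimes nonneg_matD)
  then show ?thesis using assms by (simp add: one_otimes)
qed

section \<open>Isometries: composition and description by entries\<close>

lemma max_isometriesD:
  assumes "X \<in> max_isometries n k"
  shows "X \<in> nonneg_mat n k" "transpose_mat X \<otimes>\<^sub>m X = 1\<^sub>m k"
  using assms by (auto simp: max_isometries_def)

text \<open>Compressing the identity by \<open>V\<close> and then by \<open>X\<close> gives the
  identity at each stage, and the two compressions together are the one by the product.\<close>

lemma otimes_max_isometries:
  assumes V: "V \<in> max_isometries n l" and X: "X \<in> max_isometries l k" and pos: "0 < n" "0 < l"
  shows "V \<otimes>\<^sub>m X \<in> max_isometries n k"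
proof -
  note V1 = max_isometriesD[OF V] and X1 = max_isometriesD[OF X]
  have VX: "V \<otimes>\<^sub>m X \<in> nonneg_mat n k"
    by (rule otimes_nonneg_mat[OF V1(1) X1(1) pos(2)])
  have "sandwich (V \<otimes>\<^sub>m X) (1\<^sub>m n) = sandwich X (sandwich V (1\<^sub>m n))"
    using sandwich_sandwich[OF V1(1) X1(1) one_nonneg_mat pos] ..
  also have "\<dots> = 1\<^sub>m k"
    using V1 X1 by (simp add: sandwich_one)
  finally show ?thesis
    using VX by (simp add: max_isometries_def sandwich_one)
qed

text \<open>A diagonal entry of the product is a maximum of squares of nonnegative numbers, which is
  1 exactly when no number exceeds 1 and one of them equals 1. An off-diagonal entry is a maximum of
  nonnegative products, which is 0 exactly when all of them vanish.\<close>

lemma max_isometries_iff: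
  assumes "0 < n"
  shows "X \<in> max_isometries n k \<longleftrightarrow> X \<in> nonneg_mat n k
    \<and> (\<forall>p<n. \<forall>j<k. X $$ (p, j) \<le> 1)
    \<and> (\<forall>j<k. \<exists>p<n. X $$ (p, j) = 1)
    \<and> (\<forall>p<n. \<forall>i<k. \<forall>j<k. i \<noteq> j \<longrightarrow> X $$ (p, i) * X $$ (p, j) = 0)"
    (is "_ \<longleftrightarrow> _ \<and> ?le \<and> ?one \<and> ?disj")
proof (cases "X \<in> nonneg_mat n k")
  case X: True
  define S where "S i j = (\<lambda>p. X $$ (p, i) * X $$ (p, j)) ` {..<n}" for i j
  have S: "finite (S i j)" "S i j \<noteq> {}" for i j using assms by (auto simp: S_def)
  have X0: "0 \<le> X $$ (p, i)" if "p < n" "i < k" for p i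
    using X that by (simp add: nonneg_matD)
  have entry: "(transpose_mat X \<otimes>\<^sub>m X) $$ (i, j) = Max (S i j)" if "i < k" "j < k" for i j
  proof -
    have "(\<lambda>p. transpose_mat X $$ (i, p) * X $$ (p, j)) ` {..<n} = S i j"
      unfolding S_def using that X by (intro image_cong) (auto simp: nonneg_matD)
    then show ?thesis using that X by (simp add: mat_otimes_def nonneg_matD)
  qed
  have diag: "Max (S j j) = 1 \<longleftrightarrow> (\<forall>p<n. X $$ (p, j) \<le> 1) \<and> (\<exists>p<n. X $$ (p, j) = 1)"
    if "j < k" for j
  proof -
    have "x * x \<le> 1 \<longleftrightarrow> x \<le> 1" "1 = x * x \<longleftrightarrow> x = 1" if "0 \<le> x" for x :: real
      using that abs_square_le_1[of x] power2_eq_1_iff[of x]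
      by (auto simp: power2_eq_square abs_if)
    then have "(\<forall>p<n. X $$ (p, j) * X $$ (p, j) \<le> 1) \<longleftrightarrow> (\<forall>p<n. X $$ (p, j) \<le> 1)"
      and "(\<exists>p<n. 1 = X $$ (p, j) * X $$ (p, j)) \<longleftrightarrow> (\<exists>p<n. X $$ (p, j) = 1)"
      using X0 that by blast+
    then show ?thesis
      using Max_eq_iff[OF S, of j j 1] by (auto simp: S_def)
  qed
  have offdiag: "Max (S i j) = 0 \<longleftrightarrow> (\<forall>p<n. X $$ (p, i) * X $$ (p, j) = 0)"
    if "i < k" "j < k" for i j
  proof -
    have "0 \<le> X $$ (p, i) * X $$ (p, j)" if "p < n" for p
      using X0 \<open>i < k\<close> \<open>j < k\<close> that by simp
    then have "(\<forall>p<n. X $$ (p, i) * X $$ (p, j) \<le> 0) \<longleftrightarrow> (\<forall>p<n. X $$ (p, i) * X $$ (p, j) = 0)"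
      by (simp add: order.eq_iff)
    then show ?thesis
      using Max_eq_iff[OF S, of i j 0] assms by (auto simp: S_def image_iff)
  qed
  have "transpose_mat X \<otimes>\<^sub>m X = 1\<^sub>m k \<longleftrightarrow> (\<forall>i<k. \<forall>j<k. Max (S i j) = (if i = j then 1 else 0))"
  proof
    assume "transpose_mat X \<otimes>\<^sub>m X = 1\<^sub>m k"
    then show "\<forall>i<k. \<forall>j<k. Max (S i j) = (if i = j then 1 else 0)"
      using entry by (metis index_one_mat(1))
  next
    assume "\<forall>i<k. \<forall>j<k. Max (S i j) = (if i = j then 1 else 0)"
    then show "transpose_mat X \<otimes>\<^sub>m X = 1\<^sub>m k"
      using X entry by (intro eq_matI) (auto simp: mat_otimes_def nonneg_matD)
  qed
  also have "\<dots> \<longleftrightarrow> (\<forall>j<k. Max (S j j) = 1) \<and> (\<forall>i<k. \<forall>j<k. i \<noteq> j \<longrightarrow> Max (S i j) = 0)"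
    by auto
  also have "\<dots> \<longleftrightarrow> ?le \<and> ?one \<and> ?disj"
  proof -
    have "(\<forall>j<k. Max (S j j) = 1)
        \<longleftrightarrow> (\<forall>j<k. (\<forall>p<n. X $$ (p, j) \<le> 1) \<and> (\<exists>p<n. X $$ (p, j) = 1))"
      by (intro all_cong1 imp_cong refl diag)
    also have "\<dots> \<longleftrightarrow> ?le \<and> ?one" by blast
    finally have 1: "(\<forall>j<k. Max (S j j) = 1) \<longleftrightarrow> ?le \<and> ?one" .
    have "(\<forall>i<k. \<forall>j<k. i \<noteq> j \<longrightarrow> Max (S i j) = 0)
        \<longleftrightarrow> (\<forall>i<k. \<forall>j<k. i \<noteq> j \<longrightarrow> (\<forall>p<n. X $$ (p, i) * X $$ (p, j) = 0))"
      by (intro all_cong1 imp_cong refl offdiag)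
    also have "\<dots> \<longleftrightarrow> ?disj" by blast
    finally show ?thesis unfolding 1 conj_assoc by (rule arg_cong)
  qed
  finally show ?thesis using X by (simp add: max_isometries_def)
qed (simp add: max_isometries_def)

text \<open>The introduction form of the description, for matrices given by an entry function; the
  explicit isometries and the paths below are built with it.\<close>

lemma max_isometries_mat:
  assumes "0 < n"
    and "\<And>p j. p < n \<Longrightarrow> j < k \<Longrightarrow> 0 \<le> f p j \<and> f p j \<le> 1"
    and "\<And>j. j < k \<Longrightarrow> \<exists>p<n. f p j = 1"
    and "\<And>p i j. p < n \<Longrightarrow> i < k \<Longrightarrow> j < k \<Longrightarrow> i \<noteq> j \<Longrightarrow> f p i = 0 \<or> f p j = 0"
  shows "mat n k (\<lambda>(p, j). f p j) \<in> max_isometries n k"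
proof -
  have "\<exists>p<n. mat n k (\<lambda>(p, j). f p j) $$ (p, j) = 1" if "j < k" for j
    using assms(3)[OF that] that by auto
  then show ?thesis
    unfolding max_isometries_iff[OF assms(1)] nonneg_mat_def using assms(2,4) by auto
qed

section \<open>Traces of compressions as maxima over entries\<close>

lemma sandwich_le_iff:
  assumes X: "X \<in> nonneg_mat n k" and A: "A \<in> nonneg_mat n n" and "0 < n" "i < k" "j < k"
  shows "sandwich X A $$ (i, j) \<le> c
    \<longleftrightarrow> (\<forall>p<n. \<forall>q<n. X $$ (p, i) * A $$ (p, q) * X $$ (q, j) \<le> c)"
proof -
  note dims = nonneg_matD(2,3)[OF X] nonneg_matD(2,3)[OF A]
    nonneg_matD(2,3)[OF otimes_nonneg_mat[OF transpose_nonneg_mat[OF X] A \<open>0 < n\<close>]]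
  have "sandwich X A $$ (i, j) \<le> c \<longleftrightarrow> (\<forall>q<n. (transpose_mat X \<otimes>\<^sub>m A) $$ (i, q) * X $$ (q, j) \<le> c)"
    using otimes_le_iff[of "transpose_mat X \<otimes>\<^sub>m A" k n X k i j c] assms dims by simp
  \<comment> \<open>The factor \<open>X $$ (q, j)\<close> is nonnegative and moves inside the inner
    maximum.\<close>
  also have "\<dots> \<longleftrightarrow> (\<forall>q<n. \<forall>p<n. X $$ (p, i) * A $$ (p, q) * X $$ (q, j) \<le> c)"
    using otimes_mult_le_iff[of "transpose_mat X" k n A n i _ _ c] assms dims nonneg_matD(4)[OF X]
    by simp
  finally show ?thesis by blast
qed

lemma tr_otimes_le_iff:
  assumes "A \<in> carrier_mat k k" "0 < k"
  shows "tr_otimes A \<le> c \<longleftrightarrow> (\<forall>j<k. A $$ (j, j) \<le> c)"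
proof -
  have "{..<k} \<noteq> {}" using assms by auto
  then show ?thesis using assms by (auto simp: tr_otimes_def)
qed

text \<open>The trace sees only the diagonal of the compression, so both factors from
  \<open>X\<close> are taken from the same column.\<close>

lemma tr_sandwich_le_iff:
  assumes X: "X \<in> nonneg_mat n k" and A: "A \<in> nonneg_mat n n" and "0 < n" "0 < k"
  shows "tr_otimes (sandwich X A) \<le> c
    \<longleftrightarrow> (\<forall>j<k. \<forall>p<n. \<forall>q<n. X $$ (p, j) * A $$ (p, q) * X $$ (q, j) \<le> c)"
  using tr_otimes_le_iff[OF nonneg_matD(1)[OF sandwich_nonneg_mat[OF X A \<open>0 < n\<close>]] \<open>0 < k\<close>]
    sandwich_le_iff[OF X A \<open>0 < n\<close>] by simp

lemma tr_sandwich_ge: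
  assumes "X \<in> nonneg_mat n k" "A \<in> nonneg_mat n n" "j < k" "p < n" "q < n"
  shows "X $$ (p, j) * A $$ (p, q) * X $$ (q, j) \<le> tr_otimes (sandwich X A)"
  using tr_sandwich_le_iff[of X n k A "tr_otimes (sandwich X A)"] assms by auto

lemma W_maxI:
  "X \<in> max_isometries n k \<Longrightarrow> map (\<lambda>A. tr_otimes (sandwich X A)) As \<in> W_max n k As"
  unfolding W_max_def by blast

lemma W_maxE:
  assumes "w \<in> W_max n k As"
  obtains X where "X \<in> max_isometries n k" "w = map (\<lambda>A. tr_otimes (sandwich X A)) As"
  using assms unfolding W_max_def by blast

text \<open>A maximum of finitely many polynomials in the entries of \<open>X\<close>: the form in
  which continuity of the trace is visible.\<close>

lemma tr_sandwich_eq_Max: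
  assumes "X \<in> nonneg_mat n k" "A \<in> nonneg_mat n n" "0 < n" "0 < k"
  shows "tr_otimes (sandwich X A)
    = (MAX (j, p, q)\<in>{..<k} \<times> {..<n} \<times> {..<n}. X $$ (p, j) * A $$ (p, q) * X $$ (q, j))"
proof (rule real_eqI_le_iff)
  fix c
  have "{..<k} \<times> {..<n} \<times> {..<n} \<noteq> {}" using assms by auto
  then show "tr_otimes (sandwich X A) \<le> c \<longleftrightarrow>
      (MAX (j, p, q)\<in>{..<k} \<times> {..<n} \<times> {..<n}. X $$ (p, j) * A $$ (p, q) * X $$ (q, j)) \<le> c"
    using tr_sandwich_le_iff[OF assms, of c] by (auto simp: Max_le_iff)
qed

section \<open>Unit columns and principal submatrices\<close>

lemma tr_principal_submat:
  assumes "idx \<noteq> []"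
  shows "tr_otimes (principal_submat idx A) = (MAX i\<in>set idx. A $$ (i, i))"
proof -
  have "(\<lambda>j. principal_submat idx A $$ (j, j)) ` {..<length idx} = (\<lambda>i. A $$ (i, i)) ` set idx"
    by (auto simp: principal_submat_def set_conv_nth)
  then show ?thesis by (simp add: tr_otimes_def principal_submat_def)
qed

abbreviation (input) unit_cols :: "nat \<Rightarrow> nat list \<Rightarrow> real mat" where
  "unit_cols n idx \<equiv> mat_of_cols n (map (unit_vec n) idx)"

lemma unit_cols_index:
  assumes "p < n" "j < length idx" "set idx \<subseteq> {..<n}"
  shows "unit_cols n idx $$ (p, j) = (if p = idx ! j then 1 else 0)"
proof -
  have "idx ! j < n" using assms nth_mem by blast
  then show ?thesis using assms by (simp add: mat_of_cols_index)
qed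

lemma unit_cols_max_isometries:
  assumes "0 < n" "distinct idx" "set idx \<subseteq> {..<n}"
  shows "unit_cols n idx \<in> max_isometries n (length idx)"
proof -
  have "idx ! j < n" if "j < length idx" for j using assms that nth_mem by blast
  moreover have "unit_cols n idx = mat n (length idx) (\<lambda>(p, j). if p = idx ! j then 1 else 0)"
    by (rule eq_matI) (use assms in \<open>simp_all add: unit_cols_index\<close>)
  ultimately show ?thesis
    using assms by (auto intro!: max_isometries_mat simp: nth_eq_iff_index_eq)
qed

text \<open>Each unit column has a single nonzero entry, so at most one term of the maximum
  survives; all others are 0 and lie below the nonnegative entry of \<open>A\<close>.\<close>

lemma sandwich_unit_cols:
  assumes A: "A \<in> nonneg_mat n n" and "0 < n" "distinct idx" and idx: "set idx \<subseteq> {..<n}"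
  shows "sandwich (unit_cols n idx) A = principal_submat idx A"
proof (rule eq_matI)
  have V: "unit_cols n idx \<in> nonneg_mat n (length idx)"
    using assms by (intro max_isometriesD unit_cols_max_isometries)
  have dims: "sandwich (unit_cols n idx) A \<in> nonneg_mat (length idx) (length idx)"
    using sandwich_nonneg_mat V A \<open>0 < n\<close> by blast
  show "dim_row (sandwich (unit_cols n idx) A) = dim_row (principal_submat idx A)"
    "dim_col (sandwich (unit_cols n idx) A) = dim_col (principal_submat idx A)"
    using nonneg_matD(2,3)[OF dims] by (simp_all add: principal_submat_def)
  fix i j assume "i < dim_row (principal_submat idx A)" "j < dim_col (principal_submat idx A)"
  then have ij: "i < length idx" "j < length idx" by (auto simp: principal_submat_def)
  then have n: "idx ! i < n" "idx ! j < n" using idx nth_mem by blast+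
  show "sandwich (unit_cols n idx) A $$ (i, j) = principal_submat idx A $$ (i, j)"
  proof (rule real_eqI_le_iff)
    fix c
    have "sandwich (unit_cols n idx) A $$ (i, j) \<le> c \<longleftrightarrow> (\<forall>p<n. \<forall>q<n.
        (if p = idx ! i then 1 else 0) * A $$ (p, q) * (if q = idx ! j then 1 else 0) \<le> c)"
      using sandwich_le_iff[OF V A \<open>0 < n\<close> ij] ij idx by (simp add: unit_cols_index)
    also have "\<dots> \<longleftrightarrow> A $$ (idx ! i, idx ! j) \<le> c"
      using n nonneg_matD(4)[OF A n] by (auto split: if_splits)
    finally show "sandwich (unit_cols n idx) A $$ (i, j) \<le> c
        \<longleftrightarrow> principal_submat idx A $$ (i, j) \<le> c"
      using ij by (simp add: principal_submat_def)
  qed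
qed

section \<open>Ranges of compressions; permutation matrices\<close>

text \<open>An isometry \<open>X\<close> used for the compressed tuple can be replaced by
  \<open>V \<otimes>\<^sub>m X\<close> for the original one.\<close>

lemma W_max_sandwich_subset:
  assumes V: "V \<in> max_isometries n l" and As: "set As \<subseteq> nonneg_mat n n" and pos: "0 < n" "0 < l"
  shows "W_max l k (map (sandwich V) As) \<subseteq> W_max n k As"
proof
  fix w assume "w \<in> W_max l k (map (sandwich V) As)"
  then obtain X where X: "X \<in> max_isometries l k"
    and w: "w = map (\<lambda>A. tr_otimes (sandwich X A)) (map (sandwich V) As)"
    by (rule W_maxE)
  have "w = map (\<lambda>A. tr_otimes (sandwich (V \<otimes>\<^sub>m X) A)) As"
    using As sandwich_sandwich[OF max_isometriesD(1)[OF V] max_isometriesD(1)[OF X] _ pos]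
    by (auto simp: w)
  then show "w \<in> W_max n k As"
    using W_maxI[OF otimes_max_isometries[OF V X pos], of As] by (simp only:)
qed

text \<open>Choose in every column a row with entry 1. Two columns with the same chosen row would
  have product 1 there, against disjointness of supports.\<close>

lemma max_isometries_rows:
  assumes X: "X \<in> max_isometries n k" and "0 < n"
  obtains r where "\<And>j. j < k \<Longrightarrow> r j < n" "\<And>j. j < k \<Longrightarrow> X $$ (r j, j) = 1" "inj_on r {..<k}"
proof -
  note iff = X[unfolded max_isometries_iff[OF \<open>0 < n\<close>]]
  obtain r where r: "\<And>j. j < k \<Longrightarrow> r j < n \<and> X $$ (r j, j) = 1"
  proof -
    have "\<forall>j. \<exists>p. j < k \<longrightarrow> p < n \<and> X $$ (p, j) = 1" using iff by blast
    then show ?thesis using that by metis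
  qed
  have "inj_on r {..<k}"
  proof (intro inj_onI, rule ccontr)
    fix i j assume ij: "i \<in> {..<k}" "j \<in> {..<k}" "r i = r j" "i \<noteq> j"
    then have "X $$ (r i, i) * X $$ (r i, j) = 0" using iff r by blast
    moreover have "X $$ (r i, i) = 1" "X $$ (r i, j) = 1" using r[of i] r[of j] ij by simp_all
    ultimately show False by simp
  qed
  then show ?thesis using that r by blast
qed

text \<open>For a square isometry the injective choice of rows is a permutation. Any other row of
  column \<open>j\<close> is the chosen row of a different column, whose entry 1 forces the entry in
  column \<open>j\<close> to vanish.\<close>

lemma max_unitaries_unit_cols:
  assumes U: "U \<in> max_unitaries n" and "0 < n"
  obtains idx where "distinct idx" "set idx = {..<n}" "U = unit_cols n idx"
proof -
  have U': "U \<in> max_isometries n n" using U by (simp add: max_unitaries_def)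
  obtain \<sigma> where \<sigma>: "\<And>j. j < n \<Longrightarrow> \<sigma> j < n" "\<And>j. j < n \<Longrightarrow> U $$ (\<sigma> j, j) = 1" "inj_on \<sigma> {..<n}"
    using max_isometries_rows[OF U' \<open>0 < n\<close>] by metis
  have surj: "\<sigma> ` {..<n} = {..<n}"
    using \<sigma> by (intro endo_inj_surj) auto
  have zero: "U $$ (p, j) = 0" if "p < n" "j < n" "p \<noteq> \<sigma> j" for p j
  proof -
    have "p \<in> \<sigma> ` {..<n}" using that(1) surj by simp
    then obtain i where i: "i < n" "p = \<sigma> i" by blast
    then have "i \<noteq> j" using that by blast
    then have "U $$ (p, i) * U $$ (p, j) = 0"
      using U'[unfolded max_isometries_iff[OF \<open>0 < n\<close>]] that i by blast
    then show ?thesis using \<sigma>(2)[OF i(1)] i by simp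
  qed
  let ?idx = "map \<sigma> [0..<n]"
  have idx: "distinct ?idx" "set ?idx = {..<n}"
    using \<sigma>(3) surj by (simp_all add: distinct_map atLeast0LessThan)
  moreover have "U = unit_cols n ?idx"
  proof (rule eq_matI)
    fix p j assume "p < dim_row (unit_cols n ?idx)" "j < dim_col (unit_cols n ?idx)"
    then have "p < n" "j < n" by simp_all
    then show "U $$ (p, j) = unit_cols n ?idx $$ (p, j)"
      using unit_cols_index[of p n j ?idx] idx(2) zero \<sigma>(2) by simp
  qed (use max_isometriesD(1)[OF U'] in \<open>simp_all add: nonneg_matD\<close>)
  ultimately show ?thesis using that by blast
qed

text \<open>Provides the right inverse of a unitary. Every \<open>p\<close> occurs in
  \<open>idx\<close>, which puts a 1 into column \<open>p\<close> of the transpose; supports are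
  disjoint because row \<open>j\<close> has its only 1 in column \<open>idx ! j\<close>.\<close>

lemma transpose_max_unitaries:
  assumes U: "U \<in> max_unitaries n" and "0 < n"
  shows "transpose_mat U \<in> max_unitaries n"
proof -
  obtain idx where idx: "distinct idx" "set idx = {..<n}" "U = unit_cols n idx"
    using max_unitaries_unit_cols[OF assms] by metis
  then have len: "length idx = n" using distinct_card[of idx] by simp
  have "transpose_mat U = mat n n (\<lambda>(j, p). if p = idx ! j then 1 else 0)"
    using idx len by (intro eq_matI) (simp_all add: unit_cols_index)
  moreover have "\<dots> \<in> max_isometries n n"
  proof (rule max_isometries_mat[OF \<open>0 < n\<close>])
    show "\<exists>j<n. (if p = idx ! j then 1 else 0) = (1::real)" if "p < n" for p
    proof -
      have "p \<in> set idx" using idx that by simp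
      then show ?thesis using len by (auto simp: in_set_conv_nth)
    qed
  qed auto
  ultimately show ?thesis by (simp add: max_unitaries_def)
qed

lemma W_max_sandwich_unitary:
  assumes U: "U \<in> max_unitaries n" and As: "set As \<subseteq> nonneg_mat n n" and "0 < n"
  shows "W_max n k (map (sandwich U) As) = W_max n k As"
proof
  have U': "U \<in> max_isometries n n" using U by (simp add: max_unitaries_def)
  have UT: "transpose_mat U \<in> max_isometries n n"
    using transpose_max_unitaries[OF U \<open>0 < n\<close>] by (simp add: max_unitaries_def)
  show "W_max n k (map (sandwich U) As) \<subseteq> W_max n k As"
    by (rule W_max_sandwich_subset[OF U' As \<open>0 < n\<close> \<open>0 < n\<close>])
  show "W_max n k As \<subseteq> W_max n k (map (sandwich U) As)"
  proof
    fix w assume "w \<in> W_max n k As"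
    then obtain X where X: "X \<in> max_isometries n k"
      and w: "w = map (\<lambda>A. tr_otimes (sandwich X A)) As"
      by (rule W_maxE)
    \<comment> \<open>Chosen so that \<open>U \<otimes>\<^sub>m Y = X\<close>, which is where the
      transpose being an isometry enters.\<close>
    define Y where "Y = transpose_mat U \<otimes>\<^sub>m X"
    have Y: "Y \<in> max_isometries n k"
      unfolding Y_def by (rule otimes_max_isometries[OF UT X \<open>0 < n\<close> \<open>0 < n\<close>])
    have "U \<otimes>\<^sub>m Y = U \<otimes>\<^sub>m transpose_mat U \<otimes>\<^sub>m X"
      unfolding Y_def
      by (rule otimes_assoc[OF max_isometriesD(1)[OF U'] max_isometriesD(1)[OF UT]
          max_isometriesD(1)[OF X] \<open>0 < n\<close> \<open>0 < n\<close>, symmetric])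
    also have "\<dots> = X"
      using max_isometriesD[OF UT] max_isometriesD[OF X] by (simp add: one_otimes)
    finally have "sandwich Y (sandwich U A) = sandwich X A" if "A \<in> nonneg_mat n n" for A
      using sandwich_sandwich[OF max_isometriesD(1)[OF U'] max_isometriesD(1)[OF Y] that \<open>0 < n\<close> \<open>0 < n\<close>]
      by simp
    then have "w = map (\<lambda>A. tr_otimes (sandwich Y A)) (map (sandwich U) As)"
      using As by (auto simp: w)
    then show "w \<in> W_max n k (map (sandwich U) As)"
      using W_maxI[OF Y, of "map (sandwich U) As"] by (simp only:)
  qed
qed

lemma W_max_principal_submat_subset:
  assumes "0 < n" "set As \<subseteq> nonneg_mat n n" "distinct idx" "set idx \<subseteq> {..<n}" "idx \<noteq> []"
  shows "W_max (length idx) k (map (principal_submat idx) As) \<subseteq> W_max n k As"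
proof -
  have "sandwich (unit_cols n idx) A = principal_submat idx A" if "A \<in> set As" for A
    by (rule sandwich_unit_cols) (use assms that in auto)
  then have eq: "map (principal_submat idx) As = map (sandwich (unit_cols n idx)) As"
    by (metis (no_types, lifting) map_cong)
  show ?thesis
    unfolding eq using assms by (intro W_max_sandwich_subset unit_cols_max_isometries) auto
qed

section \<open>The case of full size, and scalar multiples\<close>

text \<open>Square isometries are permutation matrices, and these only permute the diagonal of
  \<open>A\<close>, which leaves the largest diagonal entry unchanged.\<close>

lemma W_max_full:
  assumes As: "set As \<subseteq> nonneg_mat n n" and "0 < n"
  shows "W_max n n As = {map tr_otimes As}"
proof -
  have "tr_otimes (sandwich U A) = tr_otimes A"
    if U: "U \<in> max_isometries n n" and A: "A \<in> nonneg_mat n n" for U A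
  proof -
    obtain idx where idx: "distinct idx" "set idx = {..<n}" "U = unit_cols n idx"
      using max_unitaries_unit_cols[OF U[folded max_unitaries_def] \<open>0 < n\<close>] .
    have "sandwich U A = principal_submat idx A"
      unfolding idx(3) by (rule sandwich_unit_cols[OF A \<open>0 < n\<close> idx(1)]) (simp add: idx(2))
    moreover have "idx \<noteq> []" using idx(2) \<open>0 < n\<close> by (metis empty_iff lessThan_iff list.set(1))
    ultimately have "tr_otimes (sandwich U A) = (MAX i\<in>{..<n}. A $$ (i, i))"
      using tr_principal_submat idx(2) by simp
    then show ?thesis using A by (simp add: tr_otimes_def nonneg_matD)
  qed
  then have eq: "map (\<lambda>A. tr_otimes (sandwich U A)) As = map tr_otimes As"
    if "U \<in> max_isometries n n" for U
    using As that by auto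
  \<comment> \<open>The identity shows that the range is not empty.\<close>
  have I: "1\<^sub>m n \<in> max_isometries n n"
    using one_otimes[OF one_nonneg_mat] one_nonneg_mat by (simp add: max_isometries_def)
  have "map tr_otimes As \<in> W_max n n As"
    using W_maxI[OF I, of As] eq[OF I] by (simp only:)
  moreover have "w = map tr_otimes As" if "w \<in> W_max n n As" for w
    using that by (rule W_maxE) (simp only: eq)
  ultimately show ?thesis by blast
qed

lemma tr_otimes_smult:
  assumes A: "A \<in> nonneg_mat n n" and "0 < n" "0 \<le> \<alpha>"
  shows "tr_otimes (\<alpha> \<cdot>\<^sub>m A) = \<alpha> * tr_otimes A"
proof (rule real_eqI_le_iff)
  fix c
  have "tr_otimes (\<alpha> \<cdot>\<^sub>m A) \<le> c \<longleftrightarrow> (\<forall>i<n. A $$ (i, i) * \<alpha> \<le> c)"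
    using tr_otimes_le_iff[of "\<alpha> \<cdot>\<^sub>m A" n c] A \<open>0 < n\<close> by (auto simp: nonneg_mat_def mult.commute)
  also have "\<dots> \<longleftrightarrow> \<alpha> * tr_otimes A \<le> c"
    using Max_image_mult_le_iff[of "{..<n}" \<alpha> "\<lambda>i. A $$ (i, i)" c] A \<open>0 < n\<close> \<open>0 \<le> \<alpha>\<close>
    by (auto simp: tr_otimes_def nonneg_matD mult.commute lessThan_empty_iff)
  finally show "tr_otimes (\<alpha> \<cdot>\<^sub>m A) \<le> c \<longleftrightarrow> \<alpha> * tr_otimes A \<le> c" .
qed

section \<open>Entrywise maxima of tuples\<close>

lemma mat_oplus_nonneg_mat:
  "A \<in> nonneg_mat n k \<Longrightarrow> B \<in> nonneg_mat n k \<Longrightarrow> A \<oplus>\<^sub>m B \<in> nonneg_mat n k"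
  by (auto simp: nonneg_mat_def mat_oplus_def le_max_iff_disj)

text \<open>The weight \<open>X $$ (p, j) * X $$ (q, j)\<close> is nonnegative and hence distributes
  over the maximum of the two entries.\<close>

lemma tr_sandwich_oplus:
  assumes X: "X \<in> nonneg_mat n k" and A: "A \<in> nonneg_mat n n" and B: "B \<in> nonneg_mat n n"
    and pos: "0 < n" "0 < k"
  shows "tr_otimes (sandwich X (A \<oplus>\<^sub>m B)) = max (tr_otimes (sandwich X A)) (tr_otimes (sandwich X B))"
proof (rule real_eqI_le_iff)
  fix c
  have "X $$ (p, j) * (A \<oplus>\<^sub>m B) $$ (p, q) * X $$ (q, j) \<le> c
      \<longleftrightarrow> X $$ (p, j) * A $$ (p, q) * X $$ (q, j) \<le> c \<and> X $$ (p, j) * B $$ (p, q) * X $$ (q, j) \<le> c"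
    if "p < n" "q < n" "j < k" for p q j
  proof -
    have "0 \<le> X $$ (p, j) * X $$ (q, j)" using X that by (simp add: nonneg_matD(4))
    then have "X $$ (p, j) * X $$ (q, j) * max (A $$ (p, q)) (B $$ (p, q))
        = max (X $$ (p, j) * X $$ (q, j) * A $$ (p, q)) (X $$ (p, j) * X $$ (q, j) * B $$ (p, q))"
      by (simp add: max_mult_distrib_left)
    then show ?thesis using A that by (simp add: mat_oplus_def nonneg_matD mult_ac)
  qed
  then show "tr_otimes (sandwich X (A \<oplus>\<^sub>m B)) \<le> c
      \<longleftrightarrow> max (tr_otimes (sandwich X A)) (tr_otimes (sandwich X B)) \<le> c"
    unfolding max.bounded_iff tr_sandwich_le_iff[OF X A pos] tr_sandwich_le_iff[OF X B pos]
      tr_sandwich_le_iff[OF X mat_oplus_nonneg_mat[OF A B] pos]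
    by auto
qed

text \<open>Only terms with \<open>p = q\<close> can be nonzero. They are \<alpha> times the square
  of a number in the unit interval, and the value \<alpha> is reached where column 0 has its entry
  1.\<close>

lemma tr_sandwich_smult_one:
  assumes X: "X \<in> max_isometries n k" and "0 \<le> \<alpha>" and pos: "0 < n" "0 < k"
  shows "tr_otimes (sandwich X (\<alpha> \<cdot>\<^sub>m 1\<^sub>m n)) = \<alpha>"
proof (rule antisym)
  note iff = X[unfolded max_isometries_iff[OF pos(1)]]
  have I: "\<alpha> \<cdot>\<^sub>m 1\<^sub>m n \<in> nonneg_mat n n" using \<open>0 \<le> \<alpha>\<close> by (auto simp: nonneg_mat_def)
  have X1: "0 \<le> X $$ (p, j) \<and> X $$ (p, j) \<le> 1" if "p < n" "j < k" for p j
    using iff that by (auto simp: nonneg_matD)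
  show "tr_otimes (sandwich X (\<alpha> \<cdot>\<^sub>m 1\<^sub>m n)) \<le> \<alpha>"
    unfolding tr_sandwich_le_iff[OF max_isometriesD(1)[OF X] I pos]
  proof (intro allI impI)
    fix j p q assume "j < k" "p < n" "q < n"
    moreover have "X $$ (p, j) * X $$ (p, j) * \<alpha> \<le> 1 * 1 * \<alpha>"
      using X1[of p j] \<open>j < k\<close> \<open>p < n\<close> \<open>0 \<le> \<alpha>\<close> by (intro mult_mono) auto
    ultimately show "X $$ (p, j) * (\<alpha> \<cdot>\<^sub>m 1\<^sub>m n) $$ (p, q) * X $$ (q, j) \<le> \<alpha>"
      using \<open>0 \<le> \<alpha>\<close> by (auto simp: mult_ac)
  qed
  obtain p where p: "p < n" "X $$ (p, 0) = 1" using iff pos by auto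
  show "\<alpha> \<le> tr_otimes (sandwich X (\<alpha> \<cdot>\<^sub>m 1\<^sub>m n))"
    using tr_sandwich_ge[OF max_isometriesD(1)[OF X] I pos(2) p(1) p(1)] p by simp
qed

lemma map_tr_sandwich_oplus:
  assumes "X \<in> nonneg_mat n k" "set As \<subseteq> nonneg_mat n n" "set Bs \<subseteq> nonneg_mat n n"
    and "length As = length Bs" "0 < n" "0 < k"
  shows "map (\<lambda>A. tr_otimes (sandwich X A)) (As \<oplus>\<^sub>t Bs)
    = map2 max (map (\<lambda>A. tr_otimes (sandwich X A)) As) (map (\<lambda>A. tr_otimes (sandwich X A)) Bs)"
proof (rule nth_equalityI)
  fix i assume "i < length (map (\<lambda>A. tr_otimes (sandwich X A)) (As \<oplus>\<^sub>t Bs))"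
  then have i: "i < length As" "i < length Bs" using assms by (auto simp: mats_oplus_def)
  then have "As ! i \<in> nonneg_mat n n" "Bs ! i \<in> nonneg_mat n n" using assms nth_mem by blast+
  then show "map (\<lambda>A. tr_otimes (sandwich X A)) (As \<oplus>\<^sub>t Bs) ! i
      = map2 max (map (\<lambda>A. tr_otimes (sandwich X A)) As) (map (\<lambda>A. tr_otimes (sandwich X A)) Bs) ! i"
    using i assms by (simp add: mats_oplus_def tr_sandwich_oplus)
qed (simp add: mats_oplus_def)

text \<open>One isometry serves both tuples on the left, while the right side may combine two
  different ones; hence an inclusion.\<close>

lemma W_max_oplus_subset:
  assumes "set As \<subseteq> nonneg_mat n n" "set Bs \<subseteq> nonneg_mat n n" "length As = length Bs" "0 < n" "0 < k"
  shows "W_max n k (As \<oplus>\<^sub>t Bs) \<subseteq> W_max n k As \<oplus>\<^sub>s W_max n k Bs"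
proof
  fix w assume "w \<in> W_max n k (As \<oplus>\<^sub>t Bs)"
  then obtain X where X: "X \<in> max_isometries n k"
    and "w = map (\<lambda>A. tr_otimes (sandwich X A)) (As \<oplus>\<^sub>t Bs)"
    by (rule W_maxE)
  then have "w = map2 max (map (\<lambda>A. tr_otimes (sandwich X A)) As) (map (\<lambda>A. tr_otimes (sandwich X A)) Bs)"
    using map_tr_sandwich_oplus assms max_isometriesD(1) by metis
  then show "w \<in> W_max n k As \<oplus>\<^sub>s W_max n k Bs"
    using X unfolding set_oplus_def W_max_def by blast
qed

text \<open>Here equality holds because the scalar matrices contribute the same tuple for every
  isometry.\<close>

lemma W_max_oplus_scalars:
  assumes As: "set As \<subseteq> nonneg_mat n n" and len: "length \<alpha>s = length As"
    and nonneg: "\<forall>\<alpha>\<in>set \<alpha>s. 0 \<le> \<alpha>" and pos: "0 < n" "0 < k"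
  shows "W_max n k (As \<oplus>\<^sub>t map (\<lambda>\<alpha>. \<alpha> \<cdot>\<^sub>m 1\<^sub>m n) \<alpha>s) = W_max n k As \<oplus>\<^sub>s {\<alpha>s}"
proof -
  have Bs: "set (map (\<lambda>\<alpha>. \<alpha> \<cdot>\<^sub>m 1\<^sub>m n) \<alpha>s) \<subseteq> nonneg_mat n n"
    using nonneg by (auto simp: nonneg_mat_def)
  have "map (\<lambda>A. tr_otimes (sandwich X A)) (As \<oplus>\<^sub>t map (\<lambda>\<alpha>. \<alpha> \<cdot>\<^sub>m 1\<^sub>m n) \<alpha>s)
      = map2 max (map (\<lambda>A. tr_otimes (sandwich X A)) As) \<alpha>s" if X: "X \<in> max_isometries n k" for X
  proof -
    have "map (\<lambda>A. tr_otimes (sandwich X A)) (map (\<lambda>\<alpha>. \<alpha> \<cdot>\<^sub>m 1\<^sub>m n) \<alpha>s) = \<alpha>s"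
      using nonneg by (simp add: map_idI tr_sandwich_smult_one[OF X _ pos])
    then show ?thesis
      using map_tr_sandwich_oplus[OF max_isometriesD(1)[OF X] As Bs _ pos] len by simp
  qed
  then have "W_max n k (As \<oplus>\<^sub>t map (\<lambda>\<alpha>. \<alpha> \<cdot>\<^sub>m 1\<^sub>m n) \<alpha>s)
      = {map2 max (map (\<lambda>A. tr_otimes (sandwich X A)) As) \<alpha>s | X. X \<in> max_isometries n k}"
    unfolding W_max_def by (intro Collect_cong ex_cong1) auto
  also have "\<dots> = W_max n k As \<oplus>\<^sub>s {\<alpha>s}"
    unfolding set_oplus_def W_max_def by blast
  finally show ?thesis .
qed

section \<open>Dropping a column of an isometry\<close>

lemma W_max_Suc_subset:
  assumes As: "set As \<subseteq> nonneg_mat n n" and "length As \<le> k" "0 < k" "0 < n"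
  shows "W_max n (Suc k) As \<subseteq> W_max n k As"
proof
  fix w assume "w \<in> W_max n (Suc k) As"
  then obtain X where X: "X \<in> max_isometries n (Suc k)"
    and w: "w = map (\<lambda>A. tr_otimes (sandwich X A)) As"
    by (rule W_maxE)
  have nonneg: "sandwich X A \<in> nonneg_mat (Suc k) (Suc k)" if "A \<in> set As" for A
    using sandwich_nonneg_mat[OF max_isometriesD(1)[OF X] _ \<open>0 < n\<close>] As that by auto
  have "\<exists>j<Suc k. tr_otimes (sandwich X A) = sandwich X A $$ (j, j)" if "A \<in> set As" for A
  proof -
    have "tr_otimes (sandwich X A) \<in> (\<lambda>j. sandwich X A $$ (j, j)) ` {..<Suc k}"
      unfolding tr_otimes_def nonneg_matD(2)[OF nonneg[OF that]]
      by (rule Max_in) (auto simp: lessThan_empty_iff)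
    then show ?thesis by auto
  qed
  then obtain col where col: "\<And>A. A \<in> set As \<Longrightarrow> col A < Suc k"
    "\<And>A. A \<in> set As \<Longrightarrow> tr_otimes (sandwich X A) = sandwich X A $$ (col A, col A)"
    by metis
  \<comment> \<open>Pigeonhole: at most \<open>k\<close> columns are needed to attain all traces,
    and there are \<open>k + 1\<close>.\<close>
  have "card (col ` set As) < card {..<Suc k}"
    using card_image_le[of "set As" col] card_length[of As] \<open>length As \<le> k\<close> by simp
  then obtain j where j: "j < Suc k" "j \<notin> col ` set As"
    by (metis card_mono finite_imageI finite_set lessThan_iff not_less subsetI)
  define idx where "idx = sorted_list_of_set ({..<Suc k} - {j})"
  have idx: "set idx = {..<Suc k} - {j}" "distinct idx" "length idx = k"
    using j by (simp_all add: idx_def)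
  \<comment> \<open>Multiplication by \<open>V\<close> from the right deletes column
    \<open>j\<close> of \<open>X\<close>.\<close>
  define V where "V = unit_cols (Suc k) idx"
  have V: "V \<in> max_isometries (Suc k) k"
    using unit_cols_max_isometries[of "Suc k" idx] idx by (auto simp: V_def)
  have "tr_otimes (sandwich (X \<otimes>\<^sub>m V) A) = tr_otimes (sandwich X A)" if A: "A \<in> set As" for A
  proof -
    have "sandwich (X \<otimes>\<^sub>m V) A = sandwich V (sandwich X A)"
      using sandwich_sandwich[OF max_isometriesD(1)[OF X] max_isometriesD(1)[OF V]] As A \<open>0 < n\<close>
      by auto
    also have "\<dots> = principal_submat idx (sandwich X A)"
      unfolding V_def by (rule sandwich_unit_cols[OF nonneg[OF A]]) (use idx in auto)
    finally have "tr_otimes (sandwich (X \<otimes>\<^sub>m V) A) = (MAX i\<in>set idx. sandwich X A $$ (i, i))"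
      using tr_principal_submat[of idx] idx \<open>0 < k\<close> by auto
    also have "\<dots> = sandwich X A $$ (col A, col A)"
    \<comment> \<open>No remaining diagonal entry exceeds the old trace, and the column attaining it
      is kept because it differs from \<open>j\<close>.\<close>
    proof (rule Max_eqI)
      fix y assume "y \<in> (\<lambda>i. sandwich X A $$ (i, i)) ` set idx"
      then show "y \<le> sandwich X A $$ (col A, col A)"
        using tr_otimes_le_iff[OF nonneg_matD(1)[OF nonneg[OF A]], of "tr_otimes (sandwich X A)"]
          col(2)[OF A] idx by auto
    qed (use col(1)[OF A] j A idx in auto)
    finally show ?thesis using col(2)[OF A] by simp
  qed
  then have "w = map (\<lambda>A. tr_otimes (sandwich (X \<otimes>\<^sub>m V) A)) As" by (simp add: w)
  moreover have "X \<otimes>\<^sub>m V \<in> max_isometries n k"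
    using otimes_max_isometries[OF X V] \<open>0 < n\<close> by simp
  ultimately show "w \<in> W_max n k As" using W_maxI by metis
qed

section \<open>Paths of isometries and the interval of attained traces\<close>

text \<open>Along a path with continuous entries the trace is a finite maximum of continuous
  functions, so the intermediate value theorem applies; the matrix found lies on the path and is an
  isometry.\<close>

lemma tr_sandwich_intermediate_value:
  fixes F :: "real \<Rightarrow> nat \<Rightarrow> nat \<Rightarrow> real"
  assumes "a \<le> b" and A: "A \<in> nonneg_mat n n" and pos: "0 < n" "0 < k"
    and iso: "\<And>\<theta>. \<theta> \<in> {a..b} \<Longrightarrow> mat n k (\<lambda>(p, j). F \<theta> p j) \<in> max_isometries n k"
    and cont: "\<And>p j. continuous_on {a..b} (\<lambda>\<theta>. F \<theta> p j)"
    and le: "tr_otimes (sandwich (mat n k (\<lambda>(p, j). F a p j)) A) \<le> x"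
    and ge: "x \<le> tr_otimes (sandwich (mat n k (\<lambda>(p, j). F b p j)) A)"
  shows "\<exists>X\<in>max_isometries n k. tr_otimes (sandwich X A) = x"
proof -
  define I where "I = {..<k} \<times> {..<n} \<times> {..<n}"
  define g where "g i \<theta> = (case i of (j, p, q) \<Rightarrow> F \<theta> p j * A $$ (p, q) * F \<theta> q j)" for i \<theta>
  have I: "finite I" "I \<noteq> {}" using pos by (auto simp: I_def)
  have eq: "tr_otimes (sandwich (mat n k (\<lambda>(p, j). F \<theta> p j)) A) = (MAX i\<in>I. g i \<theta>)"
    if "\<theta> \<in> {a..b}" for \<theta>
  proof -
    let ?X = "mat n k (\<lambda>(p, j). F \<theta> p j)"
    have "(\<lambda>(j, p, q). ?X $$ (p, j) * A $$ (p, q) * ?X $$ (q, j)) ` I = (\<lambda>i. g i \<theta>) ` I"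
      by (intro image_cong) (auto simp: I_def g_def)
    then show ?thesis
      using tr_sandwich_eq_Max[OF max_isometriesD(1)[OF iso[OF that]] A pos] by (simp add: I_def)
  qed
  have "continuous_on {a..b} (g i)" if "i \<in> I" for i
    unfolding g_def by (cases i) (auto intro!: continuous_intros cont)
  then have "continuous_on {a..b} (\<lambda>\<theta>. MAX i\<in>I. g i \<theta>)"
    by (rule continuous_on_Max_image[OF I])
  moreover have "(MAX i\<in>I. g i a) \<le> x" "x \<le> (MAX i\<in>I. g i b)"
    using le ge eq \<open>a \<le> b\<close> by auto
  ultimately obtain \<theta> where "a \<le> \<theta>" "\<theta> \<le> b" "(MAX i\<in>I. g i \<theta>) = x"
    using IVT'[of "\<lambda>\<theta>. MAX i\<in>I. g i \<theta>" a x b] \<open>a \<le> b\<close> by auto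
  then show ?thesis using eq iso by (metis atLeastAtMost_iff)
qed

lemma tr_sandwich_attains:
  assumes A: "A \<in> nonneg_mat n n" and idx: "distinct idx" "set idx \<subseteq> {..<n}" "length idx = k"
    and k: "0 < k" "k < n" and pq: "p < n" "q < n"
    and le: "tr_otimes (principal_submat idx A) \<le> x" and ge: "x \<le> A $$ (p, q)"
  shows "\<exists>X\<in>max_isometries n k. tr_otimes (sandwich X A) = x"
proof -
  have "0 < n" using k by simp
  have idx_n: "idx ! j < n" if "j < k" for j using idx that nth_mem by blast
  have idx_inj: "idx ! i = idx ! j \<longleftrightarrow> i = j" if "i < k" "j < k" for i j
    using idx that nth_eq_iff_index_eq by metis
  have start: "tr_otimes (sandwich (unit_cols n idx) A) \<le> x"
    unfolding sandwich_unit_cols[OF A \<open>0 < n\<close> idx(1,2)] by (rule le)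
  have "unit_cols n idx \<in> carrier_mat n k"
    using idx(3) mat_of_cols_carrier(1)[of n "map (unit_vec n) idx"] by simp
  then have unit_cols_eqI: "mat n k (\<lambda>(u, c). f u c) = unit_cols n idx"
    if "\<And>u c. u < n \<Longrightarrow> c < k \<Longrightarrow> f u c = (if u = idx ! c then 1 else 0)" for f
    using that idx(2,3) by (intro eq_matI) (auto simp: unit_cols_index)
  \<comment> \<open>Either at most one column of the starting matrix uses a row among
    \<open>p\<close> and \<open>q\<close>, or two different columns do. In the second case
    distinctness of \<open>idx\<close> makes one of them \<open>p\<close> and the other
    \<open>q\<close>.\<close>
  consider (add) j where "j < k" "\<And>c. c < k \<Longrightarrow> c \<noteq> j \<Longrightarrow> idx ! c \<noteq> p \<and> idx ! c \<noteq> q"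
    | (swap) a b where "a < k" "b < k" "a \<noteq> b" "idx ! a = p" "idx ! b = q"
  proof (cases "\<exists>j<k. \<forall>c<k. c \<noteq> j \<longrightarrow> idx ! c \<noteq> p \<and> idx ! c \<noteq> q")
    case False
    then obtain c where c: "c < k" "idx ! c \<in> {p, q}" using k by blast
    then obtain d where d: "d < k" "d \<noteq> c" "idx ! d \<in> {p, q}" using False by blast
    show ?thesis using swap[of c d] swap[of d c] c d idx_inj[of c d] by auto
  qed (use add in blast)
  then show ?thesis
  proof cases
    \<comment> \<open>Column \<open>j\<close> grows from a unit vector until it contains the rows \<open>p\<close> and \<open>q\<close>.\<close>
    case add
    define F :: "real \<Rightarrow> nat \<Rightarrow> nat \<Rightarrow> real" where
      "F \<theta> u c = (if u = idx ! c then 1 else if c = j \<and> (u = p \<or> u = q) then \<theta> else 0)" for \<theta> u c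
    have iso: "mat n k (\<lambda>(u, c). F \<theta> u c) \<in> max_isometries n k" if "\<theta> \<in> {0..1}" for \<theta>
    proof (rule max_isometries_mat[OF \<open>0 < n\<close>])
      show "\<exists>u<n. F \<theta> u c = 1" if "c < k" for c
        using idx_n[OF that] by (auto simp: F_def)
      \<comment> \<open>The rows added to column \<open>j\<close> are occupied by no other
        column.\<close>
      show "F \<theta> u c = 0 \<or> F \<theta> u d = 0" if "u < n" "c < k" "d < k" "c \<noteq> d" for u c d
        using that idx_inj[of c d] add(2)[of c] add(2)[of d] by (auto simp: F_def)
    qed (use that in \<open>auto simp: F_def\<close>)
    show ?thesis
    proof (rule tr_sandwich_intermediate_value[OF zero_le_one A \<open>0 < n\<close> k(1) iso])
      show "continuous_on {0..1} (\<lambda>\<theta>. F \<theta> u c)" for u c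
        by (cases "u = idx ! c"; cases "c = j"; cases "u = p"; cases "u = q") (simp_all add: F_def)
      show "tr_otimes (sandwich (mat n k (\<lambda>(u, c). F 0 u c)) A) \<le> x"
      proof -
        have "F 0 u c = (if u = idx ! c then 1 else 0)" for u c
          by (simp add: F_def)
        then have "mat n k (\<lambda>(u, c). F 0 u c) = unit_cols n idx" by (rule unit_cols_eqI)
        then show ?thesis using start by (simp only:)
      qed
      \<comment> \<open>At the end of the path column \<open>j\<close> has entry 1 in both rows, so
        the entry of \<open>A\<close> itself is a term of the trace.\<close>
      have "A $$ (p, q) \<le> tr_otimes (sandwich (mat n k (\<lambda>(u, c). F 1 u c)) A)"
        using tr_sandwich_ge[OF max_isometriesD(1)[OF iso[of 1]] A add(1) pq] add(1) pq
        by (simp add: F_def split: if_splits)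
      with ge show "x \<le> tr_otimes (sandwich (mat n k (\<lambda>(u, c). F 1 u c)) A)" by simp
    qed
  next
    \<comment> \<open>Both rows already occur, in different columns. Since \<open>k < n\<close>, some row \<open>r\<close> is free: column
      \<open>b\<close> first takes up \<open>r\<close>, then gives up \<open>q\<close>, and finally column \<open>a\<close> takes up \<open>q\<close>.\<close>
    case swap
    have "card (set idx) < card {..<n}" using k idx distinct_card[of idx] by simp
    then obtain r where r: "r < n" "r \<notin> set idx"
      by (metis card_mono finite_set lessThan_iff not_less subsetI)
    then have rc: "idx ! c \<noteq> r" if "c < k" for c using idx that by auto
    \<comment> \<open>The three moves take place on \<open>[0, 1]\<close>, \<open>[1, 2]\<close> and
      \<open>[2, 3]\<close>; \<open>max\<close> and \<open>min\<close> freeze each entry outside its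
      own phase.\<close>
    define F :: "real \<Rightarrow> nat \<Rightarrow> nat \<Rightarrow> real" where
      "F \<theta> u c = (if c = b then (if u = q then max 0 (min 1 (2 - \<theta>)) else if u = r then min 1 \<theta> else 0)
        else if c = a \<and> u = q then max 0 (\<theta> - 2) else if u = idx ! c then 1 else 0)" for \<theta> u c
    \<comment> \<open>Row \<open>q\<close> is the only place where columns \<open>a\<close> and
      \<open>b\<close> could meet: \<open>b\<close> occupies it only before time 2 and
      \<open>a\<close> only after. Row \<open>r\<close> lies outside \<open>idx\<close> and meets no
      other column.\<close>
    have supp_b: "u = q \<and> \<theta> < 2 \<or> u = r" if "F \<theta> u b \<noteq> 0" for \<theta> u
      using that by (auto simp: F_def split: if_splits)
    have supp: "c = a \<and> u = q \<and> 2 < \<theta> \<or> u = idx ! c" if "c \<noteq> b" "F \<theta> u c \<noteq> 0" for \<theta> u c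
      using that by (auto simp: F_def split: if_splits)
    have iso: "mat n k (\<lambda>(u, c). F \<theta> u c) \<in> max_isometries n k" if "\<theta> \<in> {0..3}" for \<theta>
    proof (rule max_isometries_mat[OF \<open>0 < n\<close>])
      show "\<exists>u<n. F \<theta> u c = 1" if "c < k" for c
      proof (cases "c = b")
        case True
        \<comment> \<open>Column \<open>b\<close> always keeps an entry 1: in row \<open>q\<close>
          for \<open>\<theta> \<le> 1\<close> and in row \<open>r\<close> for
          \<open>\<theta> \<ge> 1\<close>.\<close>
        have "F \<theta> q c = 1 \<or> F \<theta> r c = 1"
          using True rc[OF swap(2)] swap by (auto simp: F_def)
        then show ?thesis using pq r by blast
      next
        case False
        then have "F \<theta> (idx ! c) c = 1"
          using idx_inj[OF \<open>c < k\<close> swap(2)] swap by (auto simp: F_def)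
        then show ?thesis using idx_n[OF that] by blast
      qed
      show "F \<theta> u c = 0 \<or> F \<theta> u d = 0" if "u < n" "c < k" "d < k" "c \<noteq> d" for u c d
      proof (rule ccontr)
        assume "\<not> ?thesis"
        then have nz: "F \<theta> u c \<noteq> 0" "F \<theta> u d \<noteq> 0" by auto
        have b: False if "e < k" "e \<noteq> b" "F \<theta> u b \<noteq> 0" "F \<theta> u e \<noteq> 0" for e
          using supp_b[OF that(3)] supp[OF that(2,4)] idx_inj[OF that(1) swap(2)] rc[OF that(1)]
            rc[OF swap(2)] that(2) swap(5) by auto
        show False
        proof (cases "c = b \<or> d = b")
          case True
          then show False using b[of c] b[of d] that nz by auto
        next
          case False
          then show False
            using supp[OF _ nz(1)] supp[OF _ nz(2)] idx_inj[OF that(2,3)] idx_inj[OF that(2) swap(2)]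
              idx_inj[OF that(3) swap(2)] that(4) swap(5) by auto
        qed
      qed
    qed (use that in \<open>auto simp: F_def\<close>)
    show ?thesis
    proof (rule tr_sandwich_intermediate_value[OF _ A \<open>0 < n\<close> k(1) iso])
      show "continuous_on {0..3} (\<lambda>\<theta>. F \<theta> u c)" for u c
        by (cases "c = b"; cases "c = a"; cases "u = q"; cases "u = r"; cases "u = idx ! c")
          (auto simp: F_def intro!: continuous_intros)
      show "tr_otimes (sandwich (mat n k (\<lambda>(u, c). F 0 u c)) A) \<le> x"
      proof -
        have "F 0 u c = (if u = idx ! c then 1 else 0)" for u c
          using swap(3,4,5) idx_inj[OF swap(1,2)] by (auto simp: F_def)
        then have "mat n k (\<lambda>(u, c). F 0 u c) = unit_cols n idx" by (rule unit_cols_eqI)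
        then show ?thesis using start by (simp only:)
      qed
      have "F 3 p a = 1" "F 3 q a = 1"
        using swap idx_inj[OF swap(1,2)] by (auto simp: F_def)
      then have "A $$ (p, q) \<le> tr_otimes (sandwich (mat n k (\<lambda>(u, c). F 3 u c)) A)"
        using tr_sandwich_ge[OF max_isometriesD(1)[OF iso[of 3]] A swap(1) pq] swap(1) pq
        by simp
      with ge show "x \<le> tr_otimes (sandwich (mat n k (\<lambda>(u, c). F 3 u c)) A)" by simp
    qed simp_all
  qed
qed

text \<open>For a constant tuple the range is the set of single traces, copied \<open>m\<close>
  times. It remains to bound these traces by \<open>s\<close> and \<open>t\<close> and to attain
  every value between.\<close>

lemma W_max_replicate:
  assumes A: "A \<in> nonneg_mat n n" and k: "0 < k" "k < n"
  defines "s \<equiv> MIN idx \<in> {idx. length idx = k \<and> sorted_wrt (<) idx \<and> set idx \<subseteq> {..<n}}.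
      MAX j\<in>{..<k}. A $$ (idx ! j, idx ! j)"
    and "t \<equiv> MAX (i, j)\<in>{..<n} \<times> {..<n}. A $$ (i, j)"
  shows "W_max n k (replicate m A) = {replicate m a | a. s \<le> a \<and> a \<le> t}"
proof -
  \<comment> \<open>Strictly increasing lists represent the index sets of size \<open>k\<close>;
    this set is finite and nonempty, so the minimum is attained.\<close>
  define L where "L = {idx. length idx = k \<and> sorted_wrt (<) idx \<and> set idx \<subseteq> {..<n}}"
  have "0 < n" using k by simp
  have "L \<subseteq> {idx. set idx \<subseteq> {..<n} \<and> length idx = k}" by (auto simp: L_def)
  then have L: "finite L" using finite_lists_length_eq[of "{..<n}" k] by (auto intro: finite_subset)
  have "[0..<k] \<in> L" using k by (auto simp: L_def)
  then have L0: "L \<noteq> {}" by blast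
  have tr_L: "(MAX j\<in>{..<k}. A $$ (idx ! j, idx ! j)) = tr_otimes (principal_submat idx A)"
    if "idx \<in> L" for idx
  proof -
    have "(\<lambda>j. A $$ (idx ! j, idx ! j)) ` {..<k} = (\<lambda>i. A $$ (i, i)) ` set idx"
      using that by (auto simp: L_def set_conv_nth)
    moreover have "idx \<noteq> []" using that k by (auto simp: L_def)
    ultimately show ?thesis by (simp add: tr_principal_submat)
  qed
  have s: "s = (MIN idx\<in>L. tr_otimes (principal_submat idx A))"
    unfolding s_def L_def[symmetric] using tr_L by (simp cong: image_cong)
  have "s \<in> (\<lambda>idx. tr_otimes (principal_submat idx A)) ` L"
    unfolding s by (rule Min_in) (use L L0 in auto)
  then obtain idx where idx: "idx \<in> L" "s = tr_otimes (principal_submat idx A)" by blast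
  have "{..<n} \<times> {..<n} \<noteq> {}" using \<open>0 < n\<close> by auto
  then have "t \<in> (\<lambda>(i, j). A $$ (i, j)) ` ({..<n} \<times> {..<n})"
    unfolding t_def by (intro Max_in) auto
  then obtain p q where pq: "p < n" "q < n" "t = A $$ (p, q)" by auto
  have lower: "s \<le> tr_otimes (sandwich X A)" if X: "X \<in> max_isometries n k" for X
  proof -
    obtain r where r: "\<And>j. j < k \<Longrightarrow> r j < n" "\<And>j. j < k \<Longrightarrow> X $$ (r j, j) = 1" "inj_on r {..<k}"
      using max_isometries_rows[OF X \<open>0 < n\<close>] by metis
    \<comment> \<open>The rows carrying the entries 1 form an index set of size \<open>k\<close>,
      and each of their diagonal entries is a term of the trace.\<close>
    define rs where "rs = sorted_list_of_set (r ` {..<k})"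
    have rs: "set rs = r ` {..<k}" "length rs = k" "sorted_wrt (<) rs"
      using r(3) by (simp_all add: rs_def card_image)
    then have "rs \<in> L" using r(1) by (auto simp: L_def)
    then have "s \<le> tr_otimes (principal_submat rs A)" using L s by simp
    also have "\<dots> = (MAX i\<in>set rs. A $$ (i, i))"
      using rs(2) k by (intro tr_principal_submat) auto
    also have "\<dots> \<le> tr_otimes (sandwich X A)"
    proof (rule Max.boundedI)
      fix y assume "y \<in> (\<lambda>i. A $$ (i, i)) ` set rs"
      then obtain j where "j < k" "y = A $$ (r j, r j)" using rs(1) by auto
      then show "y \<le> tr_otimes (sandwich X A)"
        using tr_sandwich_ge[OF max_isometriesD(1)[OF X] A, of j "r j" "r j"] r(1,2)[of j] by simp
    qed (use rs k in auto)
    finally show ?thesis .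
  qed
  have upper: "tr_otimes (sandwich X A) \<le> t" if X: "X \<in> max_isometries n k" for X
    unfolding tr_sandwich_le_iff[OF max_isometriesD(1)[OF X] A \<open>0 < n\<close> k(1)]
  proof (intro allI impI)
    fix j u v assume juv: "j < k" "u < n" "v < n"
    have "0 \<le> X $$ (i, j) \<and> X $$ (i, j) \<le> 1" if "i < n" for i
      using X[unfolded max_isometries_iff[OF \<open>0 < n\<close>]] juv(1) that by (auto simp: nonneg_matD)
    then have "X $$ (u, j) * A $$ (u, v) * X $$ (v, j) \<le> 1 * A $$ (u, v) * 1"
      using juv nonneg_matD(4)[OF A] by (intro mult_mono) auto
    also have "\<dots> \<le> t"
      unfolding t_def using juv by (auto intro!: Max_ge)
    finally show "X $$ (u, j) * A $$ (u, v) * X $$ (v, j) \<le> t" .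
  qed
  have "\<exists>X\<in>max_isometries n k. tr_otimes (sandwich X A) = a" if "s \<le> a" "a \<le> t" for a
  proof (rule tr_sandwich_attains[OF A])
    show "distinct idx" "set idx \<subseteq> {..<n}" "length idx = k"
      using idx(1) strict_sorted_iff[of idx] by (auto simp: L_def)
  qed (use k pq idx(2) that in auto)
  then have "(\<lambda>X. tr_otimes (sandwich X A)) ` max_isometries n k = {a. s \<le> a \<and> a \<le> t}"
    using lower upper by (auto simp: image_iff)
  then have "replicate m ` (\<lambda>X. tr_otimes (sandwich X A)) ` max_isometries n k
      = {replicate m a | a. s \<le> a \<and> a \<le> t}"
    by auto
  then show ?thesis by (auto simp: W_max_def image_image)
qed

section \<open>Block diagonal matrices\<close>

text \<open>The two blocks are the principal submatrices on the first \<open>n\<close> and the last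
  \<open>p\<close> indices, so the inclusion for principal submatrices applies to both.\<close>

lemma W_max_block_diag_subset:
  assumes As: "set As \<subseteq> nonneg_mat n n" and Bs: "set Bs \<subseteq> nonneg_mat p p"
    and len: "length As = length Bs" and pos: "0 < n" "0 < p"
  shows "W_max n k As \<union> W_max p k Bs
    \<subseteq> W_max (n + p) k (map2 (\<lambda>A B. four_block_mat A (0\<^sub>m n p) (0\<^sub>m p n) B) As Bs)"
    (is "_ \<subseteq> W_max _ _ ?Ds")
proof -
  define D where "D A B = four_block_mat A (0\<^sub>m n p) (0\<^sub>m p n) B" for A B :: "real mat"
  have D: "D A B \<in> nonneg_mat (n + p) (n + p)"
    and D_upper: "principal_submat [0..<n] (D A B) = A"
    and D_lower: "principal_submat [n..<n + p] (D A B) = B"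
    if "A \<in> nonneg_mat n n" "B \<in> nonneg_mat p p" for A B
    using that by (auto simp: D_def nonneg_mat_def principal_submat_def)
  have nths: "As ! i \<in> nonneg_mat n n" "Bs ! i \<in> nonneg_mat p p" if "i < length As" for i
    using As Bs len that by auto
  have Ds: "?Ds = map2 D As Bs" by (simp add: D_def)
  have "set (map2 D As Bs) \<subseteq> nonneg_mat (n + p) (n + p)"
    using As Bs by (auto intro!: D dest: set_zip_leftD set_zip_rightD)
  note sub = W_max_principal_submat_subset[OF _ this]
  have "map (principal_submat [0..<n]) (map2 D As Bs) = As"
    "map (principal_submat [n..<n + p]) (map2 D As Bs) = Bs"
    using len nths D_upper D_lower by (auto intro!: nth_equalityI)
  moreover have "{0..<n} \<subseteq> {..<n + p}" "{n..<n + p} \<subseteq> {..<n + p}" by auto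
  ultimately have "W_max n k As \<subseteq> W_max (n + p) k ?Ds" "W_max p k Bs \<subseteq> W_max (n + p) k ?Ds"
    using sub[of "[0..<n]" k] sub[of "[n..<n + p]" k] pos unfolding Ds by auto
  then show ?thesis by blast
qed

theorem theorem4p7:
  fixes n m k :: nat and As :: "real mat list"
  assumes "length As = m" and "set As \<subseteq> nonneg_mat n n"
    and "1 \<le> k" and "k \<le> n"
  shows
    \<comment> \<open>(i)\<close>
    "(\<forall>A \<in> nonneg_mat n n. As = replicate m A \<longrightarrow>
        (k < n \<longrightarrow>
          (let s = (MIN idx \<in> {idx. length idx = k \<and> sorted_wrt (<) idx \<and> set idx \<subseteq> {..<n}}.
                      MAX j\<in>{..<k}. A $$ (idx ! j, idx ! j));
               t = (MAX (i, j)\<in>{..<n} \<times> {..<n}. A $$ (i, j))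
           in W_max n k As = {replicate m a | a. s \<le> a \<and> a \<le> t})) \<and>
        (k = n \<longrightarrow> W_max n n As = {replicate m (tr_otimes A)}))
    \<and>
    \<comment> \<open>(ii)\<close>
     (\<forall>\<alpha>s. length \<alpha>s = m \<and> (\<forall>\<alpha>\<in>set \<alpha>s. 0 \<le> \<alpha>) \<longrightarrow>
        W_max n k (As \<oplus>\<^sub>t map (\<lambda>\<alpha>. \<alpha> \<cdot>\<^sub>m 1\<^sub>m n) \<alpha>s) = W_max n k As \<oplus>\<^sub>s {\<alpha>s}) \<and>
     (\<forall>Bs. length Bs = m \<and> set Bs \<subseteq> nonneg_mat n n \<longrightarrow>
        W_max n k (As \<oplus>\<^sub>t Bs) \<subseteq> W_max n k As \<oplus>\<^sub>s W_max n k Bs)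
    \<and>
    \<comment> \<open>(iii)\<close>
     (\<forall>U \<in> max_unitaries n.
        W_max n k (map (\<lambda>A. transpose_mat U \<otimes>\<^sub>m A \<otimes>\<^sub>m U) As) = W_max n k As)
    \<and>
    \<comment> \<open>(iv)\<close>
     (\<forall>\<alpha>s. length \<alpha>s = m \<and> (\<forall>\<alpha>\<in>set \<alpha>s. 0 \<le> \<alpha>) \<longrightarrow>
        W_max n n (map2 (\<lambda>\<alpha> A. \<alpha> \<cdot>\<^sub>m A) \<alpha>s As) = {map2 (\<lambda>\<alpha> A. \<alpha> * tr_otimes A) \<alpha>s As})
    \<and>
    \<comment> \<open>(v)\<close>
     (\<forall>l idx. length idx = l \<and> distinct idx \<and> set idx \<subseteq> {..<n} \<and> k \<le> l \<longrightarrow>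
        W_max l k (map (principal_submat idx) As) \<subseteq> W_max n k As) \<and>
     (\<forall>s idx V. length idx = s \<and> distinct idx \<and> set idx \<subseteq> {..<n} \<and> k \<le> s \<and> s \<le> n \<and>
          V = mat_of_cols n (map (unit_vec n) idx) \<longrightarrow>
        W_max s k (map (\<lambda>A. transpose_mat V \<otimes>\<^sub>m A \<otimes>\<^sub>m V) As) \<subseteq> W_max n k As \<and>
        (s = n \<longrightarrow>
          W_max s k (map (\<lambda>A. transpose_mat V \<otimes>\<^sub>m A \<otimes>\<^sub>m V) As) = W_max n k As))
    \<and>
    \<comment> \<open>(vi)\<close>
     (\<forall>p Bs. length Bs = m \<and> set Bs \<subseteq> nonneg_mat p p \<and> k \<le> min n p \<longrightarrow>
        W_max n k As \<union> W_max p k Bs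
          \<subseteq> W_max (n + p) k
              (map2 (\<lambda>A B. four_block_mat A (0\<^sub>m n p) (0\<^sub>m p n) B) As Bs))
    \<and>
    \<comment> \<open>(vii)\<close>
     (m < k + 1 \<and> k < n \<longrightarrow> W_max n (k + 1) As \<subseteq> W_max n k As)"
proof (intro conjI)
  note As = assms(2)
  have pos: "0 < n" "0 < k" using assms by auto
  show "\<forall>A\<in>nonneg_mat n n. As = replicate m A \<longrightarrow>
        (k < n \<longrightarrow>
          (let s = (MIN idx \<in> {idx. length idx = k \<and> sorted_wrt (<) idx \<and> set idx \<subseteq> {..<n}}.
                      MAX j\<in>{..<k}. A $$ (idx ! j, idx ! j));
               t = (MAX (i, j)\<in>{..<n} \<times> {..<n}. A $$ (i, j))
           in W_max n k As = {replicate m a | a. s \<le> a \<and> a \<le> t})) \<and>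
        (k = n \<longrightarrow> W_max n n As = {replicate m (tr_otimes A)})"
    unfolding Let_def
  proof (intro ballI impI conjI)
    fix A assume A: "A \<in> nonneg_mat n n" and eq: "As = replicate m A"
    show "W_max n k As = {replicate m a | a.
        (MIN idx \<in> {idx. length idx = k \<and> sorted_wrt (<) idx \<and> set idx \<subseteq> {..<n}}.
          MAX j\<in>{..<k}. A $$ (idx ! j, idx ! j)) \<le> a \<and>
        a \<le> (MAX (i, j)\<in>{..<n} \<times> {..<n}. A $$ (i, j))}" if "k < n"
      unfolding eq by (rule W_max_replicate[OF A pos(2) that])
    show "W_max n n As = {replicate m (tr_otimes A)}"
      unfolding W_max_full[OF As pos(1)] unfolding eq by simp
  qed
  show "\<forall>\<alpha>s. length \<alpha>s = m \<and> (\<forall>\<alpha>\<in>set \<alpha>s. 0 \<le> \<alpha>) \<longrightarrow>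
        W_max n k (As \<oplus>\<^sub>t map (\<lambda>\<alpha>. \<alpha> \<cdot>\<^sub>m 1\<^sub>m n) \<alpha>s) = W_max n k As \<oplus>\<^sub>s {\<alpha>s}"
    using W_max_oplus_scalars[OF As _ _ pos] assms(1) by simp
  show "\<forall>Bs. length Bs = m \<and> set Bs \<subseteq> nonneg_mat n n \<longrightarrow>
        W_max n k (As \<oplus>\<^sub>t Bs) \<subseteq> W_max n k As \<oplus>\<^sub>s W_max n k Bs"
    using W_max_oplus_subset[OF As _ _ pos] assms(1) by simp
  show "\<forall>U\<in>max_unitaries n. W_max n k (map (sandwich U) As) = W_max n k As"
    using W_max_sandwich_unitary[OF _ As pos(1)] by blast
  show "\<forall>\<alpha>s. length \<alpha>s = m \<and> (\<forall>\<alpha>\<in>set \<alpha>s. 0 \<le> \<alpha>) \<longrightarrow>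
        W_max n n (map2 (\<lambda>\<alpha> A. \<alpha> \<cdot>\<^sub>m A) \<alpha>s As) = {map2 (\<lambda>\<alpha> A. \<alpha> * tr_otimes A) \<alpha>s As}"
  proof (intro allI impI)
    fix \<alpha>s :: "real list" assume \<alpha>s: "length \<alpha>s = m \<and> (\<forall>\<alpha>\<in>set \<alpha>s. 0 \<le> \<alpha>)"
    then have zip: "0 \<le> \<alpha> \<and> A \<in> nonneg_mat n n" if "(\<alpha>, A) \<in> set (zip \<alpha>s As)" for \<alpha> A
      using that As by (auto dest: set_zip_leftD set_zip_rightD)
    then have "set (map2 (\<lambda>\<alpha> A. \<alpha> \<cdot>\<^sub>m A) \<alpha>s As) \<subseteq> nonneg_mat n n"
      by (fastforce simp: nonneg_mat_def)
    \<comment> \<open>The range of full size is the single tuple of traces, so only the scaling of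
      each trace is left.\<close>
    moreover have "map tr_otimes (map2 (\<lambda>\<alpha> A. \<alpha> \<cdot>\<^sub>m A) \<alpha>s As) = map2 (\<lambda>\<alpha> A. \<alpha> * tr_otimes A) \<alpha>s As"
      using zip by (auto simp: tr_otimes_smult[OF _ pos(1)])
    ultimately show "W_max n n (map2 (\<lambda>\<alpha> A. \<alpha> \<cdot>\<^sub>m A) \<alpha>s As) = {map2 (\<lambda>\<alpha> A. \<alpha> * tr_otimes A) \<alpha>s As}"
      using W_max_full[OF _ pos(1)] by simp
  qed
  \<comment> \<open>From \<open>0 < k\<close> and \<open>k \<le> l\<close> it follows that
    \<open>idx\<close> is nonempty.\<close>
  show "\<forall>l idx. length idx = l \<and> distinct idx \<and> set idx \<subseteq> {..<n} \<and> k \<le> l \<longrightarrow>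
        W_max l k (map (principal_submat idx) As) \<subseteq> W_max n k As"
    using W_max_principal_submat_subset[OF pos(1) As] pos(2) by force
  show "\<forall>s idx V. length idx = s \<and> distinct idx \<and> set idx \<subseteq> {..<n} \<and> k \<le> s \<and> s \<le> n \<and>
          V = unit_cols n idx \<longrightarrow>
        W_max s k (map (sandwich V) As) \<subseteq> W_max n k As \<and>
        (s = n \<longrightarrow> W_max s k (map (sandwich V) As) = W_max n k As)"
  proof (intro allI impI)
    fix s idx V
    assume asm: "length idx = s \<and> distinct idx \<and> set idx \<subseteq> {..<n} \<and> k \<le> s \<and> s \<le> n \<and>
      V = unit_cols n idx"
    then have V: "V \<in> max_isometries n s" using unit_cols_max_isometries[OF pos(1)] by blast
    have "W_max s k (map (sandwich V) As) \<subseteq> W_max n k As"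
      using W_max_sandwich_subset[OF V As pos(1)] asm pos(2) by simp
    \<comment> \<open>With \<open>s = n\<close> the matrix \<open>V\<close> is a square isometry,
      and invariance under unitaries gives equality.\<close>
    moreover have "W_max s k (map (sandwich V) As) = W_max n k As" if "s = n"
      using W_max_sandwich_unitary[OF _ As pos(1)] V that by (simp add: max_unitaries_def)
    ultimately show "W_max s k (map (sandwich V) As) \<subseteq> W_max n k As \<and>
        (s = n \<longrightarrow> W_max s k (map (sandwich V) As) = W_max n k As)" by blast
  qed
  show "\<forall>p Bs. length Bs = m \<and> set Bs \<subseteq> nonneg_mat p p \<and> k \<le> min n p \<longrightarrow>
        W_max n k As \<union> W_max p k Bs
          \<subseteq> W_max (n + p) k (map2 (\<lambda>A B. four_block_mat A (0\<^sub>m n p) (0\<^sub>m p n) B) As Bs)"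
  proof (intro allI impI)
    fix p and Bs :: "real mat list"
    assume "length Bs = m \<and> set Bs \<subseteq> nonneg_mat p p \<and> k \<le> min n p"
    then show "W_max n k As \<union> W_max p k Bs
        \<subseteq> W_max (n + p) k (map2 (\<lambda>A B. four_block_mat A (0\<^sub>m n p) (0\<^sub>m p n) B) As Bs)"
      using pos assms(1) by (intro W_max_block_diag_subset[OF As]) auto
  qed
  show "m < k + 1 \<and> k < n \<longrightarrow> W_max n (k + 1) As \<subseteq> W_max n k As"
    using W_max_Suc_subset[OF As _ pos(2,1)] assms(1) by simp
qed

end
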